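(* Let $k$ be a positive integer and let $\mathbb{F}_q$ be the finite field with $q$ elements. If $q>k^3$, then every element of $\mathbb{F}_q$ can be written as a sum of three $k$-th powers of elements of $\mathbb{F}_q$.
   Context: The element $0=0^k$ counts as a $k$-th power. *)

theory Defs
  imports Complex_Main "HOL-Library.Cardinality"
begin

end

theory Submission
  imports Defs "HOL-Computational_Algebra.Polynomial" "HOL-Analysis.Convex"
begin

text \<open>
  Let \<open>H\<close> be the group of nonzero \<open>k\<close>-th powers, \<open>m\<close> its order and \<open>q\<close> the order of the field.
  Convolution with the indicator of \<open>H\<close> acts on the \<open>H\<close>-invariant functions of mean zero, and
  averaging its kernel over \<open>H\<close> makes the Hilbert-Schmidt norm squared equal to \<open>q - m\<close>; this
  is the elementary counterpart of the bound for Gauss periods. Applying the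
  convolution twice to the indicator of \<open>H\<close>, normalised to mean zero, gives an \<open>H\<close>-invariant
  function which takes the value \<open>- m\<^sup>3 / q\<close> on the coset \<open>a H\<close> if \<open>a \<noteq> 0\<close> is not a sum of three
  elements of \<open>H\<close>. Comparing norms yields \<open>m\<^sup>6 \<le> q (q - m)\<^sup>3\<close>, whereas \<open>q - 1 \<le> k m\<close> and
  \<open>q > k\<^sup>3\<close> give \<open>m \<ge> k\<^sup>2\<close>, which contradicts this for \<open>k \<ge> 2\<close>.
\<close>

lemma sum_shift_field:
  fixes f :: "'a::{field,finite} \<Rightarrow> real"
  shows "(\<Sum>x\<in>UNIV. f (x - c)) = (\<Sum>x\<in>UNIV. f x)"
  by (rule sum.reindex_bij_witness[where i="\<lambda>x. x + c" and j="\<lambda>x. x - c"]) auto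

definition conv :: "'a::field set \<Rightarrow> ('a \<Rightarrow> real) \<Rightarrow> 'a \<Rightarrow> real" where
  "conv H f x = (\<Sum>h\<in>H. f (x - h))"

locale mult_subgroup =
  fixes H :: "'a::{field,finite} set" and q :: real
  assumes card_UNIV [simp]: "real CARD('a) = q"
    and zero_notin: "0 \<notin> H"
    and one_in: "1 \<in> H"
    and mult_in: "\<And>g h. g \<in> H \<Longrightarrow> h \<in> H \<Longrightarrow> g * h \<in> H"
begin

abbreviation m :: real where "m \<equiv> real (card H)"

definition invariant :: "('a \<Rightarrow> real) \<Rightarrow> bool" where
  "invariant f \<longleftrightarrow> (\<forall>g\<in>H. \<forall>x. f (g * x) = f x)"

text \<open>This is \<open>m\<close> times the convolution kernel averaged over dilations by
  \<open>H\<close>. The centred kernel without averaging has squared norm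
  \<open>m * (q - m)\<close>; averaging gains a factor \<open>m\<close>.\<close>

definition reps :: "'a \<Rightarrow> 'a \<Rightarrow> real" where
  "reps x y = (\<Sum>p\<in>H \<times> H. of_bool (fst p * x - snd p = y))"

lemma inj_on_mult: "g \<in> H \<Longrightarrow> inj_on ((*) g) H"
  using zero_notin by (auto simp: inj_on_def)

text \<open>An injective self-map of a finite set is onto; this does the work of inverses in
  \<open>H\<close>.\<close>

lemma mult_image: "g \<in> H \<Longrightarrow> (*) g ` H = H"
  using mult_in by (intro card_subset_eq) (auto simp: card_image inj_on_mult)

lemma sum_mult_left:
  assumes "g \<in> H"
  shows "(\<Sum>h\<in>H. F (g * h)) = (\<Sum>h\<in>H. F h :: real)"
proof -
  have "(\<Sum>h\<in>(*) g ` H. F h) = (\<Sum>h\<in>H. F (g * h))"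
    using inj_on_mult[OF assms] by (simp add: sum.reindex)
  then show ?thesis by (simp add: mult_image[OF assms])
qed

lemma q_pos: "q > 0"
  by (simp flip: card_UNIV)

lemma card_le: "m \<le> q"
  by (simp add: card_mono flip: card_UNIV)

lemma card_pos: "m > 0"
  using one_in by (auto simp: card_gt_0_iff)

lemma invariant_conv:
  assumes "invariant f"
  shows "invariant (conv H f)"
  unfolding invariant_def
proof (intro ballI allI)
  fix g x assume g: "g \<in> H"
  have "conv H f (g * x) = (\<Sum>h\<in>H. f (g * x - g * h))"
    unfolding conv_def by (rule sum_mult_left[OF g, symmetric])
  also have "\<dots> = conv H f x"
    using assms g by (simp add: conv_def invariant_def flip: right_diff_distrib)
  finally show "conv H f (g * x) = conv H f x" .
qed

lemma sum_conv: "(\<Sum>x\<in>UNIV. conv H f x) = m * (\<Sum>x\<in>UNIV. f x)"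
  unfolding conv_def by (subst sum.swap) (simp add: sum_shift_field)

lemma conv_eq_reps:
  assumes "invariant f"
  shows "m * conv H f x = (\<Sum>y\<in>UNIV. reps x y * f y)"
proof -
  \<comment> \<open>The convolution is itself invariant, so all \<open>m\<close> terms on the right
    agree.\<close>
  have "m * conv H f x = (\<Sum>g\<in>H. conv H f (g * x))"
    using invariant_conv[OF assms] by (simp add: invariant_def)
  also have "\<dots> = (\<Sum>p\<in>H \<times> H. f (fst p * x - snd p))"
    by (simp add: conv_def sum.cartesian_product split_def)
  also have "\<dots> = (\<Sum>p\<in>H \<times> H. \<Sum>y\<in>UNIV. of_bool (fst p * x - snd p = y) * f y)"
    by (simp add: of_bool_def if_distrib[of "\<lambda>t. t * _"] cong: if_cong)
  also have "\<dots> = (\<Sum>y\<in>UNIV. reps x y * f y)"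
    unfolding reps_def sum_distrib_right by (rule sum.swap)
  finally show ?thesis .
qed

lemma sum_reps: "(\<Sum>y\<in>UNIV. reps x y) = m\<^sup>2"
  unfolding reps_def
  by (subst sum.swap) (simp add: of_bool_def card_cartesian_product power2_eq_square)

text \<open>Two affine maps with distinct slopes agree at exactly one point; with equal slopes they
  agree everywhere or nowhere.\<close>

lemma sum_collisions:
  fixes g g' h h' :: 'a
  shows "(\<Sum>x\<in>UNIV. of_bool (g * x - h = g' * x - h') :: real) =
    (if g = g' then (if h = h' then q else 0) else 1)"
proof (cases "g = g'")
  case False
  then have "g * x - h = g' * x - h' \<longleftrightarrow> x = (h - h') / (g - g')" for x
    by (auto simp: field_simps)
  then show ?thesis using False by (simp add: of_bool_def)
qed simp

text \<open>The square counts pairs of affine maps that collide at \<open>x\<close>. Summing over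
  \<open>x\<close> first, equal slopes contribute \<open>m^2 * q\<close> and distinct slopes
  \<open>m^3 * (m - 1)\<close>.\<close>

lemma sum_reps_squared: "(\<Sum>x\<in>UNIV. \<Sum>y\<in>UNIV. (reps x y)\<^sup>2) = m\<^sup>2 * q + m ^ 3 * (m - 1)"
proof -
  have "(\<Sum>y\<in>UNIV. (reps x y)\<^sup>2) = (\<Sum>p\<in>H \<times> H. \<Sum>p'\<in>H \<times> H.
      of_bool (fst p * x - snd p = fst p' * x - snd p'))" for x
  proof -
    have "(\<Sum>y\<in>UNIV. (reps x y)\<^sup>2) = (\<Sum>y\<in>UNIV. \<Sum>p\<in>H \<times> H. \<Sum>p'\<in>H \<times> H.
        of_bool (fst p * x - snd p = y) * of_bool (fst p' * x - snd p' = y))"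
      by (simp only: reps_def power2_eq_square sum_product)
    also have "\<dots> = (\<Sum>p\<in>H \<times> H. \<Sum>p'\<in>H \<times> H. \<Sum>y\<in>UNIV.
        of_bool (fst p * x - snd p = y) * of_bool (fst p' * x - snd p' = y))"
      by (subst sum.swap, intro sum.cong refl, rule sum.swap)
    also have "\<dots> = (\<Sum>p\<in>H \<times> H. \<Sum>p'\<in>H \<times> H. of_bool (fst p * x - snd p = fst p' * x - snd p'))"
      by (intro sum.cong refl) (simp add: of_bool_def if_distrib[of "\<lambda>t. t * _"] eq_commute cong: if_cong)
    finally show ?thesis .
  qed
  then have "(\<Sum>x\<in>UNIV. \<Sum>y\<in>UNIV. (reps x y)\<^sup>2) = (\<Sum>x\<in>UNIV. \<Sum>p\<in>H \<times> H. \<Sum>p'\<in>H \<times> H.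
      of_bool (fst p * x - snd p = fst p' * x - snd p'))"
    by (simp only:)
  also have "\<dots> = (\<Sum>p\<in>H \<times> H. \<Sum>p'\<in>H \<times> H. \<Sum>x\<in>UNIV.
      of_bool (fst p * x - snd p = fst p' * x - snd p'))"
    by (subst sum.swap, intro sum.cong refl, rule sum.swap)
  also have "\<dots> = (\<Sum>g\<in>H. \<Sum>h\<in>H. \<Sum>g'\<in>H. \<Sum>h'\<in>H.
      if g = g' then (if h = h' then q else 0) else 1)"
    by (simp only: sum_collisions sum.cartesian_product' fst_conv snd_conv)
  also have "\<dots> = (\<Sum>g\<in>H. \<Sum>h\<in>H. \<Sum>g'\<in>H. m + (if g = g' then q - m else 0))"
    by (intro sum.cong refl) (simp add:)
  also have "\<dots> = m\<^sup>2 * q + m ^ 3 * (m - 1)"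
    by (simp add: sum.distrib power2_eq_square power3_eq_cube algebra_simps)
  finally show ?thesis .
qed

lemma sum_conv_squared_le:
  assumes "invariant f" and "(\<Sum>x\<in>UNIV. f x) = 0"
  shows "(\<Sum>x\<in>UNIV. (conv H f x)\<^sup>2) \<le> (q - m) * (\<Sum>x\<in>UNIV. (f x)\<^sup>2)"
proof -
  \<comment> \<open>This is the mean of \<open>reps x\<close> over \<open>y\<close>. Since
    \<open>f\<close> has sum zero, subtracting it from the kernel changes nothing but makes
    Cauchy-Schwarz sharper.\<close>
  define c where "c = m\<^sup>2 / q"
  have "(m * conv H f x)\<^sup>2 \<le> (\<Sum>y\<in>UNIV. (reps x y - c)\<^sup>2) * (\<Sum>y\<in>UNIV. (f y)\<^sup>2)" for x
  proof -
    have "m * conv H f x = (\<Sum>y\<in>UNIV. (reps x y - c) * f y)"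
      using assms by (simp add: conv_eq_reps left_diff_distrib sum_subtractf flip: sum_distrib_left)
    then show ?thesis by (simp add: Cauchy_Schwarz_ineq_sum)
  qed
  then have "(\<Sum>x\<in>UNIV. (m * conv H f x)\<^sup>2)
      \<le> (\<Sum>x\<in>UNIV. \<Sum>y\<in>UNIV. (reps x y - c)\<^sup>2) * (\<Sum>y\<in>UNIV. (f y)\<^sup>2)"
    unfolding sum_distrib_right by (rule sum_mono)
  also have "(\<Sum>x\<in>UNIV. \<Sum>y\<in>UNIV. (reps x y - c)\<^sup>2) = m\<^sup>2 * (q - m)"
  proof -
    have "(\<Sum>y\<in>UNIV. (reps x y - c)\<^sup>2) = (\<Sum>y\<in>UNIV. (reps x y)\<^sup>2) - c * m\<^sup>2" for x
    proof -
      have "(\<Sum>y\<in>UNIV. (reps x y - c)\<^sup>2)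
          = (\<Sum>y\<in>UNIV. (reps x y)\<^sup>2) - 2 * c * (\<Sum>y\<in>UNIV. reps x y) + q * c\<^sup>2"
        by (simp add: power2_diff sum.distrib sum_subtractf sum_distrib_left mult_ac)
      then show ?thesis using q_pos by (simp add: sum_reps c_def power2_eq_square)
    qed
    then have "(\<Sum>x\<in>UNIV. \<Sum>y\<in>UNIV. (reps x y - c)\<^sup>2)
        = m\<^sup>2 * q + m ^ 3 * (m - 1) - q * (c * m\<^sup>2)"
      by (simp only: sum_subtractf sum_reps_squared sum_constant card_UNIV)
    also have "q * (c * m\<^sup>2) = m ^ 4"
      using q_pos by (simp add: c_def flip: power_add)
    also have "m\<^sup>2 * q + m ^ 3 * (m - 1) - m ^ 4 = m\<^sup>2 * (q - m)"
      by (simp add: algebra_simps power_numeral_reduce)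
    finally show ?thesis .
  qed
  finally have "m\<^sup>2 * (\<Sum>x\<in>UNIV. (conv H f x)\<^sup>2) \<le> m\<^sup>2 * ((q - m) * (\<Sum>x\<in>UNIV. (f x)\<^sup>2))"
    by (simp add: power_mult_distrib sum_distrib_left mult.assoc)
  then show ?thesis using card_pos by (simp only: mult_le_cancel_left_pos zero_less_power)
qed

lemma sum_of_three:
  assumes "a \<noteq> 0" and big: "q * (q - m) ^ 3 < m ^ 6"
  shows "\<exists>x\<in>H. \<exists>y\<in>H. \<exists>z\<in>H. a = x + y + z"
proof (rule ccontr)
  assume no: "\<not> ?thesis"
  define u where "u x = of_bool (x \<in> H) - m / q" for x :: 'a
  define w where "w = conv H (conv H u)"
  have H: "g * x \<in> H \<longleftrightarrow> x \<in> H" if g: "g \<in> H" for g x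
  proof
    assume "g * x \<in> H"
    then obtain h where "h \<in> H" "g * x = g * h"
      using mult_image[OF g] by blast
    then show "x \<in> H" using g zero_notin by auto
  qed (use mult_in g in auto)
  have inv: "invariant u" by (simp add: invariant_def u_def H)
  have zero: "(\<Sum>x\<in>UNIV. u x) = 0"
    using q_pos by (simp add: u_def sum_subtractf)
  have u2: "(\<Sum>x\<in>UNIV. (u x)\<^sup>2) = m * (q - m) / q"
  proof -
    have "(u x)\<^sup>2 = of_bool (x \<in> H) * (1 - 2 * (m / q)) + (m / q)\<^sup>2" for x
      by (simp add: u_def power2_eq_square algebra_simps)
    then have "(\<Sum>x\<in>UNIV. (u x)\<^sup>2) = m * (1 - 2 * (m / q)) + q * (m / q)\<^sup>2"
      by (simp add: sum.distrib flip: sum_distrib_right)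
    then show ?thesis using q_pos by (simp add: power2_eq_square field_simps)
  qed
  have "(\<Sum>x\<in>UNIV. (w x)\<^sup>2) \<le> (q - m) * (\<Sum>x\<in>UNIV. (conv H u x)\<^sup>2)"
    \<comment> \<open>The norm bound applies a second time because convolution preserves both
      invariance and sum zero.\<close>
    unfolding w_def using inv zero
    by (intro sum_conv_squared_le invariant_conv) (simp_all add: sum_conv)
  also have "\<dots> \<le> (q - m) * ((q - m) * (m * (q - m) / q))"
    using sum_conv_squared_le[OF inv zero] card_le by (intro mult_left_mono) (simp_all add: u2)
  also have "\<dots> = m * (q - m) ^ 3 / q"
    by (simp add: power3_eq_cube)
  finally have upper: "(\<Sum>x\<in>UNIV. (w x)\<^sup>2) \<le> m * (q - m) ^ 3 / q" .
  have "a - y - z \<notin> H" if "y \<in> H" "z \<in> H" for y z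
    using no that by (metis diff_add_cancel)
  then have "u (a - y - z) = - (m / q)" if "y \<in> H" "z \<in> H" for y z
    using that by (simp add: u_def)
  \<comment> \<open>The double convolution at \<open>a\<close> has \<open>m^2\<close> summands, all
    equal to \<open>- (m / q)\<close>.\<close>
  then have wa: "w a = - (m ^ 3 / q)"
    by (simp add: w_def conv_def power3_eq_cube)
  have "invariant w" unfolding w_def by (intro invariant_conv inv)
  then have "m * (w a)\<^sup>2 = (\<Sum>g\<in>H. (w (g * a))\<^sup>2)"
    by (simp add: invariant_def)
  \<comment> \<open>As \<open>a\<close> is nonzero, its coset has \<open>m\<close> distinct points,
    each with the same large value of \<open>w\<close>.\<close>
  also have "\<dots> = (\<Sum>x\<in>(\<lambda>g. g * a) ` H. (w x)\<^sup>2)"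
    using \<open>a \<noteq> 0\<close> by (subst sum.reindex) (auto simp: inj_on_def)
  also have "\<dots> \<le> (\<Sum>x\<in>UNIV. (w x)\<^sup>2)"
    by (intro sum_mono2) auto
  finally have "m * (m ^ 3 / q)\<^sup>2 \<le> m * ((q - m) ^ 3 / q)"
    using upper by (simp add: wa)
  then have "(m ^ 3 / q)\<^sup>2 \<le> (q - m) ^ 3 / q"
    using card_pos by (simp only: mult_le_cancel_left_pos)
  then have "m ^ 6 \<le> q * (q - m) ^ 3"
    using q_pos by (simp add: power_divide field_simps power2_eq_square flip: power_mult)
  then show False using big by simp
qed

end

text \<open>Each fibre of the power map lies among the roots of \<open>X^k - c\<close>, of which
  there are at most \<open>k\<close>.\<close>

lemma card_nonzero_powers:
  fixes k :: nat
  assumes "k > 0"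
  shows "CARD('a::{field,finite}) - 1 \<le> k * card ((\<lambda>x::'a. x ^ k) ` (UNIV - {0}))"
proof -
  have fibre: "card {x \<in> UNIV - {0::'a}. x ^ k = c} \<le> k" for c :: 'a
  proof -
    define p where "p = monom 1 k - [:c:]"
    have deg: "degree p \<le> k"
      unfolding p_def by (intro degree_diff_le) (simp_all add: degree_monom_eq)
    \<comment> \<open>Positivity of \<open>k\<close> keeps the constant \<open>c\<close> away from
      the leading coefficient.\<close>
    have "coeff p k = 1"
      using assms by (simp add: p_def coeff_pCons split: nat.split)
    then have "p \<noteq> 0" by auto
    then have "card {x. poly p x = 0} \<le> k"
      using card_poly_roots_bound[of p] deg by simp
    moreover have "card {x \<in> UNIV - {0}. x ^ k = c} \<le> card {x. poly p x = 0}"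
      by (intro card_mono) (auto simp: p_def poly_monom)
    ultimately show ?thesis by simp
  qed
  have "card (UNIV - {0::'a})
      = (\<Sum>c\<in>(\<lambda>x::'a. x ^ k) ` (UNIV - {0}). card {x \<in> UNIV - {0}. x ^ k = c})"
    by (simp only: card_eq_sum) (rule sum.image_gen, simp)
  also have "\<dots> \<le> (\<Sum>c\<in>(\<lambda>x::'a. x ^ k) ` (UNIV - {0}). k)"
    by (intro sum_mono fibre)
  finally show ?thesis by (simp add: mult.commute)
qed

lemma power_count_bound:
  fixes k m q :: real
  assumes "2 \<le> k" "k\<^sup>2 \<le> m" "q \<le> k * m + 1" "m \<le> q"
  shows "q * (q - m) ^ 3 < m ^ 6"
proof -
  define t where "t = k * m"
  have "4 \<le> k\<^sup>2" using power_mono[of 2 k 2] assms by simp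
  then have m: "4 \<le> m" using assms by simp
  have t: "1 \<le> t" unfolding t_def using mult_mono[of 1 k 1 m] m assms by simp
  \<comment> \<open>Here \<open>q <= t + 1\<close>, and \<open>m >= 4\<close> leaves room for
    \<open>q - m <= t - 1\<close>.\<close>
  have "q * (q - m) ^ 3 \<le> (t + 1) * (t - 1) ^ 3"
    using assms m t by (intro mult_mono power_mono) (auto simp: t_def)
  also have "\<dots> = (t\<^sup>2 - 1) * (t - 1)\<^sup>2"
    by (simp add: power2_eq_square power3_eq_cube algebra_simps)
  also have "\<dots> \<le> (t\<^sup>2 - 1) * t\<^sup>2"
    using t by (intro mult_left_mono power_mono) (auto simp: one_le_power)
  also have "\<dots> < t\<^sup>2 * t\<^sup>2" using t by (intro mult_strict_right_mono) auto
  also have "\<dots> = (k\<^sup>2)\<^sup>2 * m ^ 4" by (simp add: t_def power2_eq_square power4_eq_xxxx mult_ac)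
  also have "\<dots> \<le> m\<^sup>2 * m ^ 4" using assms by (intro mult_right_mono power_mono) auto
  also have "\<dots> = m ^ 6" by (simp flip: power_add)
  finally show ?thesis .
qed

theorem theorem3p3:
  fixes k :: nat
  assumes "k > 0"
    and "CARD('a::{field,finite}) > k ^ 3"
  shows "\<forall>a::'a. \<exists>x y z::'a. a = x ^ k + y ^ k + z ^ k"
proof
  fix a :: 'a
  define H where "H = (\<lambda>x::'a. x ^ k) ` (UNIV - {0})"
  define q where "q = real CARD('a)"
  interpret mult_subgroup H q
  proof
    show "real CARD('a) = q" by (simp add: q_def)
    show "0 \<notin> H" by (auto simp: H_def)
    show "1 \<in> H" unfolding H_def by (rule image_eqI[of _ _ 1]) auto
    show "g * h \<in> H" if gh: "g \<in> H" "h \<in> H" for g h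
    proof -
      from gh obtain x y where "g = x ^ k" "x \<noteq> 0" "h = y ^ k" "y \<noteq> 0"
        unfolding H_def by auto
      then show ?thesis
        unfolding H_def by (intro image_eqI[of _ _ "x * y"]) (auto simp: power_mult_distrib)
    qed
  qed
  \<comment> \<open>Only the last case uses the norm argument, and there all three powers are
    nonzero. For \<open>k = 1\<close> the numerical inequality can fail, as at
    \<open>q = 2\<close>.\<close>
  consider "a = 0" | "k = 1" | "a \<noteq> 0" "k \<ge> 2" using assms(1) by linarith
  then show "\<exists>x y z::'a. a = x ^ k + y ^ k + z ^ k"
  proof cases
    case 1
    then show ?thesis using assms(1) by (intro exI[of _ 0]) simp
  next
    case 2
    then show ?thesis by (intro exI[of _ a] exI[of _ 0]) simp
  next
    case 3
    have le: "CARD('a) - 1 \<le> k * card H"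
      unfolding H_def by (rule card_nonzero_powers[OF assms(1)])
    moreover have "k * k\<^sup>2 = k ^ 3" by (simp add: power2_eq_square power3_eq_cube)
    \<comment> \<open>Strictness of \<open>k^3 < q\<close> absorbs the zero element left out of the
      count.\<close>
    ultimately have "k * k\<^sup>2 \<le> k * card H" using assms(2) by linarith
    then have "k\<^sup>2 \<le> card H" using assms(1) by simp
    then have "(real k)\<^sup>2 \<le> m" by (metis of_nat_le_iff of_nat_power)
    moreover have "q \<le> real k * m + 1"
    proof -
      have "CARD('a) \<le> k * card H + 1" using le by simp
      then have "real CARD('a) \<le> real (k * card H + 1)" by (simp only: of_nat_le_iff)
      then show ?thesis by simp
    qed
    ultimately have "q * (q - m) ^ 3 < m ^ 6"
      using power_count_bound[of "real k" m q] card_le 3 by simp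
    from sum_of_three[OF 3(1) this] show ?thesis by (auto simp: H_def)
  qed
qed

end
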